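(* Let $\mathcal{D}\colon\mathcal{H}^0\to\mathcal{H}^{\geq 2}$ be the drop 1 operator, let $\tau$ be the anti-automorphism of $\mathcal{H}=\mathbb{Z}\langle x,y\rangle$ interchanging $x$ and $y$, and let $\star$ be the product on $\mathcal{H}^{2,3}=\mathbb{Z}\langle z_2,z_3\rangle$ (all as defined in the context). Then for all $w_1,w_2\in\mathcal{H}^{2,3}$, \[ \mathcal{D}(w_1\tau(w_2))=w_1\star w_2 . \]
   Context: **Algebras.** $\mathcal{H}=\mathbb{Z}\langle x,y\rangle$ is the non-commutative polynomial ring over $\mathbb{Z}$ in two variables $x,y$. For each positive integer $k$ put $z_k=yx^{k-1}$. Define subrings $\mathcal{H}^{2,3}=\mathbb{Z}\langle z_2,z_3\rangle$, $\mathcal{H}^{\geq 2}=\mathbb{Z}\langle z_2,z_3,z_4,\dots\rangle$ and $\mathcal{H}^0=\mathbb{Z}+y\mathcal{H}x$, so $\mathcal{H}^{2,3}\subset\mathcal{H}^{\geq 2}\subset\mathcal{H}^0\subset\mathcal{H}$. A word in $\mathcal{H}^{2,3}$ is a (possibly empty) monomial in $z_2,z_3$. **The anti-automorphism $\tau$.** $\tau$ is the anti-automorphism of $\mathcal{H}$ (i.e. $\tau(uv)=\tau(v)\tau(u)$) with $\tau(x)=y$, $\tau(y)=x$. **The product $\star$.** $\star$ is the $\mathbb{Z}$-bilinear product on $\mathcal{H}^{2,3}$ defined inductively, for words $w,w'$ in $\mathcal{H}^{2,3}$, by - $w\star 1=1\star w=w$; - $wz_2\star w'=w\star w'z_2=(w\star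 w')z_2$; - $wz_3\star w'z_3=(w\star w'z_3)z_3+(wz_3\star w')z_3+(w\star w')z_2^3$. **The drop 1 operator $\mathcal{D}$.** Notation: let $t$ be a positive integer, $\boldsymbol{c}=(c_1,\dots,c_{2t})$ a tuple of positive integers, $S\subset\mathbb{Z}$. - $[n]=\{1,\dots,n\}$; $[2t]^1_{\boldsymbol{c}}=\{i\in[2t]\mid c_i=1\}$; $[2t]^{>1}_{\boldsymbol{c}}=\{i\in[2t]\mid c_i>1\}$. - $\mathcal{P}^{\mathrm{eo}}(S)$ is the set of $A\subset S$ such that for every integer $i$: $i\in A\cap2\mathbb{Z}\iff i+1\in A\setminus2\mathbb{Z}$. - $\mathcal{P}^{\mathrm{oe}}(S)$ is the set of $A\subset S$ such that for every integer $i$: $i\in A\setminus2\mathbb{Z}\iff i+1\in A\cap2\mathbb{Z}$. - $\mathcal{P}^{\neg\mathrm{eo}}(S)$ is the set of $A\subset S$ such that for every integer $i$: $i\in A\cap2\mathbb{Z}\implies i+1\notin A\setminus2\mathbb{Z}$. - $\mathcal{P}^{\neg\mathrm{oe}}(S)$ is the set of $A\subset S$ such that for every integer $i$: $i\in A\setminus2\mathbb{Z}\implies i+1\notin A\cap2\mathbb{Z}$. - For $A,B\subset[2t]$, write $[2t]\setminus A=\{i_1<\cdots<i_r\}$; then $\boldsymbol{c}_{(-A)}=(c_{i_1},\dots,c_{i_r})$ (the empty tuple $\varnothing$ if $A=[2t]$) and $\boldsymbol{c}_{(-A)}-\boldsymbol{\delta}_B=(c_{i_1}-\delta_{i_1\in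 B},\dots,c_{i_r}-\delta_{i_r\in B})$, where $\delta_{i\in B}=1$ if $i\in B$ and $0$ otherwise. $\mathcal{D}\colon\mathcal{H}^0\to\mathcal{H}^{\geq2}$ is the $\mathbb{Z}$-linear map determined on words as follows. Write $\mathfrak{D}(\boldsymbol{c})=\mathcal{D}(y^{c_1}x^{c_2}\cdots y^{c_{2t-1}}x^{c_{2t}})$. Set $\mathfrak{D}(\varnothing)=\mathcal{D}(1)=1$, and inductively \begin{align*} \mathfrak{D}(\boldsymbol{c})&=\sum_{\substack{A\in\mathcal{P}^{\mathrm{eo}}([2t]^1_{\boldsymbol{c}})\\ B\in\mathcal{P}^{\neg\mathrm{eo}}([2t]^{>1}_{\boldsymbol{c}})\\ \#A+\#B\geq1}}(-1)^{\#B-1}\,\mathfrak{D}(\boldsymbol{c}_{(-A)}-\boldsymbol{\delta}_B)\,x^{\#A+\#B}\\ &\quad+\sum_{\substack{A\in\mathcal{P}^{\mathrm{eo}}([2t]^1_{\boldsymbol{c}})\\ B\in\mathcal{P}^{\neg\mathrm{eo}}([2t]^{>1}_{\boldsymbol{c}})\\ \#A+\#B\geq2}}(-1)^{\#B-1}\,\mathfrak{D}(\boldsymbol{c}_{(-A)}-\boldsymbol{\delta}_B)\,z_{\#A+\#B}\\ &\quad+\sum_{\substack{A\in\mathcal{P}^{\mathrm{oe}}([2t]^1_{\boldsymbol{c}})\\ B\in\mathcal{P}^{\neg\mathrm{oe}}([2t]^{>1}_{\boldsymbol{c}})\\ \#A+\#B\geq2}}(-1)^{\#B}\,\mathfrak{D}(\boldsymbol{c}_{(-A)}-\boldsymbol{\delta}_B)\,z_{\#A+\#B}.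 \end{align*} *)

theory Defs
  imports "HOL.Hull" "HOL-Library.Poly_Mapping"
begin

section \<open>The algebra \<open>\<int>\<langle>x, y\<rangle>\<close>\<close>

datatype letter = X | Y

text \<open>Concatenation makes lists a monoid, written additively, so that the convolution product of
  \<^theory>\<open>HOL-Library.Poly_Mapping\<close> turns the finitely supported functions on words into the monoid
  ring of the free monoid, which is the non-commutative polynomial ring.\<close>

instantiation list :: (type) monoid_add
begin

definition zero_list :: "'a list" where "zero_list = []"

definition plus_list :: "'a list \<Rightarrow> 'a list \<Rightarrow> 'a list" where "plus_list = (@)"

instance by standard (simp_all add: zero_list_def plus_list_def)

end

type_synonym ncpoly = "letter list \<Rightarrow>\<^sub>0 int"

text \<open>The monomial of a word \<open>w\<close> is \<open>frag_of w\<close>, and \<open>frag_extend f\<close> is the \<open>\<int>\<close>-linear map that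
  takes the monomial of each word \<open>w\<close> to \<open>f w\<close>.\<close>

definition gx :: ncpoly where "gx = frag_of [X]"

definition gy :: ncpoly where "gy = frag_of [Y]"

text \<open>Only used for \<open>k \<ge> 1\<close>.\<close>

definition z :: "nat \<Rightarrow> ncpoly" where "z k = gy * gx ^ (k - 1)"

definition is_subring :: "'a::ring_1 set \<Rightarrow> bool" where
  "is_subring R \<longleftrightarrow> 1 \<in> R \<and> (\<forall>a\<in>R. \<forall>b\<in>R. a - b \<in> R \<and> a * b \<in> R)"

definition H23 :: "ncpoly set" where "H23 = is_subring hull {z 2, z 3}"

definition Hge2 :: "ncpoly set" where "Hge2 = is_subring hull {z k | k. k \<ge> 2}"

definition H0 :: "ncpoly set" where "H0 = {of_int n + gy * h * gx | n h. True}"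

lemma frag_of_mult: "frag_of (u :: letter list) * frag_of v = frag_of (u @ v)"
  by (simp add: mult_single plus_list_def)

lemma frag_of_Nil: "frag_of ([] :: letter list) = 1"
  by (simp add: single_one[symmetric] zero_list_def del: single_one)

lemma gx_power: "gx ^ n = frag_of (replicate n X)"
  by (induction n) (simp_all add: gx_def frag_of_mult frag_of_Nil)

lemma z_eq: "z k = frag_of (Y # replicate (k - 1) X)"
  by (simp add: z_def gx_power gy_def frag_of_mult)

lemma z_mult_gx: "k \<ge> 1 \<Longrightarrow> z k * gx ^ n = z (k + n)"
  by (simp add: z_def mult.assoc power_add[symmetric])

lemma is_subring_H0: "is_subring H0"
  unfolding is_subring_def
proof (intro conjI ballI)
  have "1 = of_int 1 + gy * 0 * gx" by simp
  then show "1 \<in> H0" unfolding H0_def by blast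
next
  fix a b assume "a \<in> H0" "b \<in> H0"
  then obtain m g n h where a: "a = of_int m + gy * g * gx" and b: "b = of_int n + gy * h * gx"
    unfolding H0_def by blast
  have "a - b = of_int (m - n) + gy * (g - h) * gx" by (simp add: a b algebra_simps)
  then show "a - b \<in> H0" unfolding H0_def by blast
  have "of_int m * (gy * h) = gy * (of_int m * h)"
    by (metis mult.assoc mult_of_int_commute)
  moreover have "(gx :: ncpoly) * of_int n = of_int n * gx" by (rule mult_of_int_commute[symmetric])
  ultimately have "a * b = of_int (m * n) + gy * (of_int m * h + g * of_int n + g * gx * gy * h) * gx"
    by (simp add: a b distrib_left distrib_right mult.assoc[symmetric])
      (simp add: mult.assoc)
  then show "a * b \<in> H0" unfolding H0_def by blast
qed

lemma is_subring_hull: "is_subring (is_subring hull S)"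
  by (rule hull_in) (auto simp: is_subring_def)

lemma z_in_Hge2: "k \<ge> 2 \<Longrightarrow> z k \<in> Hge2"
  unfolding Hge2_def by (rule hull_inc) blast

lemma H23_subset_Hge2: "H23 \<subseteq> Hge2"
  unfolding H23_def
  by (rule hull_minimal) (simp_all add: z_in_Hge2, simp add: Hge2_def is_subring_hull)

lemma Hge2_subset_H0: "Hge2 \<subseteq> H0"
  unfolding Hge2_def
proof (rule hull_minimal)
  show "{z k | k. k \<ge> 2} \<subseteq> H0"
  proof clarify
    fix k :: nat assume "k \<ge> 2"
    then obtain j where k: "k = j + 2" by (metis add.commute le_Suc_ex)
    have "z k = of_int 0 + gy * gx ^ j * gx"
      by (simp add: k z_def mult.assoc power_commutes)
    then show "z k \<in> H0" unfolding H0_def by blast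
  qed
qed (rule is_subring_H0)


section \<open>The anti-automorphism \<open>\<tau>\<close>\<close>

fun swap_letter :: "letter \<Rightarrow> letter" where
  "swap_letter X = Y"
| "swap_letter Y = X"

definition tau :: "ncpoly \<Rightarrow> ncpoly" where
  "tau = frag_extend (\<lambda>w. frag_of (rev (map swap_letter w)))"

lemma frag_extend_mult:
  fixes f :: "letter list \<Rightarrow> ncpoly"
  assumes "\<And>u v. f (u @ v) = f v * f u"
  shows "frag_extend f (p * q) = frag_extend f q * (frag_extend f p :: ncpoly)"
proof -
  have word: "frag_extend f (frag_of u * q) = frag_extend f q * f u" for u and q :: ncpoly
    using subset_UNIV[of "Poly_Mapping.keys q"]
  proof (induction q rule: frag_induction)
    case zero
    show ?case by simp
  next
    case (one v)
    show ?case by (simp add: frag_of_mult assms)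
  next
    case (diff a b)
    then show ?case by (simp add: frag_extend_diff algebra_simps)
  qed
  show ?thesis
    using subset_UNIV[of "Poly_Mapping.keys p"]
  proof (induction p rule: frag_induction)
    case zero
    show ?case by simp
  next
    case (one u)
    show ?case by (simp add: word)
  next
    case (diff a b)
    then show ?case by (simp add: frag_extend_diff algebra_simps)
  qed
qed

lemma tau_add: "tau (p + q) = tau p + tau q"
  by (simp add: tau_def frag_extend_add)

lemma tau_mult: "tau (p * q) = tau q * tau p"
  unfolding tau_def by (rule frag_extend_mult) (simp add: frag_of_mult)

lemma tau_one: "tau 1 = 1"
  by (simp add: tau_def frag_of_Nil[symmetric])

lemma tau_gx: "tau gx = gy"
  by (simp add: tau_def gx_def gy_def)

lemma tau_gy: "tau gy = gx"
  by (simp add: tau_def gx_def gy_def)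

lemma tau_tau: "tau (tau p) = p"
  using subset_UNIV[of "Poly_Mapping.keys p"]
proof (induction p rule: frag_induction)
  case zero
  show ?case by (simp add: tau_def)
next
  case (one w)
  have "map (swap_letter \<circ> swap_letter) w = w"
    by (rule map_idI) (metis comp_apply letter.exhaust swap_letter.simps)
  then show ?case by (simp add: tau_def rev_map)
next
  case (diff a b)
  then show ?case by (simp add: tau_def frag_extend_diff)
qed


lemma tau_H0:
  assumes "p \<in> H0"
  shows "tau p \<in> H0"
proof -
  obtain n h where p: "p = of_int n + gy * h * gx" using assms unfolding H0_def by blast
  have "tau (of_int n) = of_int n"
    by (induction n rule: int_induct[of _ 0])
      (use tau_one in \<open>simp_all add: tau_def frag_extend_add frag_extend_diff\<close>)
  then have "tau p = of_int n + gy * tau h * gx"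
    by (simp add: p tau_add tau_mult tau_gx tau_gy mult.assoc)
  then show ?thesis unfolding H0_def by blast
qed


section \<open>The product \<open>\<star>\<close>\<close>

text \<open>The recursion consumes the last factor \<open>z\<^sub>2 = yx\<close> or \<open>z\<^sub>3 = yxx\<close> of a word, so it runs on
  reversed words. The equations are tried in order, and the last one is a junk value
  for words that are not monomials in \<open>z\<^sub>2\<close> and \<open>z\<^sub>3\<close>.\<close>

fun star_rev :: "letter list \<Rightarrow> letter list \<Rightarrow> ncpoly" where
  "star_rev [] v = frag_of (rev v)"
| "star_rev u [] = frag_of (rev u)"
| "star_rev (X # Y # u) v = star_rev u v * z 2"
| "star_rev u (X # Y # v) = star_rev u v * z 2"
| "star_rev (X # X # Y # u) (X # X # Y # v) =
     star_rev u (X # X # Y # v) * z 3 + star_rev (X # X # Y # u) v * z 3 + star_rev u v * z 2 ^ 3"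
| "star_rev _ _ = 0"

definition star :: "ncpoly \<Rightarrow> ncpoly \<Rightarrow> ncpoly"  (infixl \<open>\<star>\<close> 70) where
  "p \<star> q = frag_extend (\<lambda>u. frag_extend (\<lambda>v. star_rev (rev u) (rev v)) q) p"

inductive_set monomials23 :: "ncpoly set" where
  "1 \<in> monomials23"
| "w \<in> monomials23 \<Longrightarrow> w * z 2 \<in> monomials23"
| "w \<in> monomials23 \<Longrightarrow> w * z 3 \<in> monomials23"

inductive_set rev_words23 :: "letter list set" where
  "[] \<in> rev_words23"
| "u \<in> rev_words23 \<Longrightarrow> X # Y # u \<in> rev_words23"
| "u \<in> rev_words23 \<Longrightarrow> X # X # Y # u \<in> rev_words23"

lemma z2: "z 2 = frag_of [Y, X]"
  by (simp add: z_eq)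

lemma z3: "z 3 = frag_of [Y, X, X]"
  by (simp add: z_eq numeral_2_eq_2)

lemma monomials23_word: "w \<in> monomials23 \<Longrightarrow> \<exists>u\<in>rev_words23. w = frag_of (rev u)"
proof (induction rule: monomials23.induct)
  case 1
  show ?case by (rule bexI[of _ "[]"]) (simp_all add: frag_of_Nil rev_words23.intros)
next
  case (2 w)
  then obtain u where "u \<in> rev_words23" "w = frag_of (rev u)" by blast
  then show ?case
    by (intro bexI[of _ "X # Y # u"]) (simp_all add: z2 frag_of_mult rev_words23.intros)
next
  case (3 w)
  then obtain u where "u \<in> rev_words23" "w = frag_of (rev u)" by blast
  then show ?case
    by (intro bexI[of _ "X # X # Y # u"]) (simp_all add: z3 frag_of_mult rev_words23.intros)
qed

lemma star_frag_of: "frag_of (rev u) \<star> frag_of (rev v) = star_rev u v"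
  by (simp add: star_def)

lemma star_rev_Nil: "star_rev u [] = frag_of (rev u)"
  by (cases u) simp_all

lemma star_rev_z2_left: "v \<in> rev_words23 \<Longrightarrow> star_rev (X # Y # u) v = star_rev u v * z 2"
  by (cases v) (simp_all add: star_rev_Nil z2 frag_of_mult)

lemma star_rev_z2_right:
  assumes "u \<in> rev_words23" "v \<in> rev_words23"
  shows "star_rev u (X # Y # v) = star_rev u v * z 2"
  using assms
proof (induction rule: rev_words23.induct)
  case 1
  show ?case by (simp add: z2 frag_of_mult)
next
  case (2 u)
  then show ?case by (simp add: star_rev_z2_left rev_words23.intros)
next
  case (3 u)
  show ?case by simp
qed

text \<open>The defining properties of \<open>\<star>\<close>.\<close>

lemma star_add_left: "(p + p') \<star> q = p \<star> q + p' \<star> q"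
  by (simp add: star_def frag_extend_add)

lemma star_add_right: "p \<star> (q + q') = p \<star> q + p \<star> q'"
  using subset_UNIV[of "Poly_Mapping.keys p"]
  by (induction p rule: frag_induction)
    (simp_all add: star_def frag_extend_add frag_extend_diff)

lemma star_one:
  assumes "w \<in> monomials23"
  shows "w \<star> 1 = w" "1 \<star> w = w"
  using monomials23_word[OF assms] star_frag_of[of _ "[]"] star_frag_of[of "[]"]
  by (auto simp: star_rev_Nil frag_of_Nil)

lemma star_z2:
  assumes "w \<in> monomials23" "w' \<in> monomials23"
  shows "(w * z 2) \<star> w' = (w \<star> w') * z 2" "w \<star> (w' * z 2) = (w \<star> w') * z 2"
proof -
  obtain u v where u: "u \<in> rev_words23" "w = frag_of (rev u)"
    and v: "v \<in> rev_words23" "w' = frag_of (rev v)"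
    using assms monomials23_word by meson
  have *: "w * z 2 = frag_of (rev (X # Y # u))" "w' * z 2 = frag_of (rev (X # Y # v))"
    by (simp_all add: u v z2 frag_of_mult)
  show "(w * z 2) \<star> w' = (w \<star> w') * z 2" "w \<star> (w' * z 2) = (w \<star> w') * z 2"
    unfolding * using u v by (simp_all only: star_frag_of star_rev_z2_left star_rev_z2_right)
qed

lemma star_z3:
  assumes "w \<in> monomials23" "w' \<in> monomials23"
  shows "(w * z 3) \<star> (w' * z 3) =
    (w \<star> (w' * z 3)) * z 3 + ((w * z 3) \<star> w') * z 3 + (w \<star> w') * z 2 ^ 3"
proof -
  obtain u v where u: "w = frag_of (rev u)" and v: "w' = frag_of (rev v)"
    using assms monomials23_word by meson
  have *: "w * z 3 = frag_of (rev (X # X # Y # u))" "w' * z 3 = frag_of (rev (X # X # Y # v))"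
    by (simp_all add: u v z3 frag_of_mult)
  show ?thesis unfolding * unfolding u v by (simp only: star_frag_of star_rev.simps)
qed


section \<open>The drop 1 operator\<close>

definition P_eo :: "int set \<Rightarrow> int set set" where
  "P_eo S = {A. A \<subseteq> S \<and> (\<forall>i. (i \<in> A \<and> even i) \<longleftrightarrow> (i + 1 \<in> A \<and> odd (i + 1)))}"

definition P_oe :: "int set \<Rightarrow> int set set" where
  "P_oe S = {A. A \<subseteq> S \<and> (\<forall>i. (i \<in> A \<and> odd i) \<longleftrightarrow> (i + 1 \<in> A \<and> even (i + 1)))}"

definition P_neo :: "int set \<Rightarrow> int set set" where
  "P_neo S = {A. A \<subseteq> S \<and> (\<forall>i. i \<in> A \<and> even i \<longrightarrow> \<not> (i + 1 \<in> A \<and> odd (i + 1)))}"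

definition P_noe :: "int set \<Rightarrow> int set set" where
  "P_noe S = {A. A \<subseteq> S \<and> (\<forall>i. i \<in> A \<and> odd i \<longrightarrow> \<not> (i + 1 \<in> A \<and> even (i + 1)))}"

text \<open>Tuples \<open>(c\<^sub>1, \<dots>, c\<^sub>n)\<close> are lists indexed from 1.\<close>

definition entry :: "nat list \<Rightarrow> int \<Rightarrow> nat" where
  "entry c i = c ! nat (i - 1)"

definition indices :: "nat list \<Rightarrow> int set" where
  "indices c = {1..int (length c)}"

definition ones :: "nat list \<Rightarrow> int set" where
  "ones c = {i \<in> indices c. entry c i = 1}"

definition bigs :: "nat list \<Rightarrow> int set" where
  "bigs c = {i \<in> indices c. entry c i > 1}"

text \<open>The tuple \<open>c\<^sub>(\<^sub>-\<^sub>A\<^sub>) - \<delta>\<^sub>B\<close>.\<close>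

definition remove_drop :: "nat list \<Rightarrow> int set \<Rightarrow> int set \<Rightarrow> nat list" where
  "remove_drop c A B =
     map (\<lambda>i. entry c i - (if i \<in> B then 1 else 0)) (sorted_list_of_set (indices c - A))"

lemma sum_list_remove_drop:
  assumes A: "A \<subseteq> ones c" and B: "B \<subseteq> bigs c" and pos: "card A + card B \<ge> 1"
  shows "sum_list (remove_drop c A B) < sum_list c"
proof -
  have fin: "finite (indices c)" by (simp add: indices_def)
  have AI: "A \<subseteq> indices c" and BI: "B \<subseteq> indices c" using A B by (auto simp: ones_def bigs_def)
  have finA: "finite A" and finB: "finite B" using AI BI fin finite_subset by blast+
  have 1: "sum_list (remove_drop c A B) = (\<Sum>i\<in>indices c - A. entry c i - (if i \<in> B then 1 else 0))"
    unfolding remove_drop_def using fin by (subst sum_list_distinct_conv_sum_set) auto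
  have 2: "sum_list c = (\<Sum>i\<in>indices c. entry c i)"
    unfolding sum_list_sum_nth indices_def entry_def
    by (rule sum.reindex_bij_witness[of _ "\<lambda>i. nat (i - 1)" "\<lambda>i. int i + 1"]) auto
  have "(\<Sum>i\<in>indices c - A. entry c i - (if i \<in> B then 1 else 0))
      = (\<Sum>i\<in>indices c. if i \<in> A then 0 else entry c i - (if i \<in> B then 1 else 0))"
    using fin by (intro sum.mono_neutral_cong_left) auto
  also have "\<dots> < (\<Sum>i\<in>indices c. entry c i)"
  proof (rule sum_strict_mono_ex1[OF fin])
    have "A \<noteq> {} \<or> B \<noteq> {}" using pos by auto
    then show "\<exists>i\<in>indices c.
        (if i \<in> A then 0 else entry c i - (if i \<in> B then 1 else 0)) < entry c i"
    proof
      assume "A \<noteq> {}"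
      then obtain i where "i \<in> A" by blast
      then show ?thesis using A by (intro bexI[of _ i]) (auto simp: ones_def)
    next
      assume "B \<noteq> {}"
      then obtain i where "i \<in> B" by blast
      then show ?thesis using B by (intro bexI[of _ i]) (auto simp: bigs_def)
    qed
  qed auto
  finally show ?thesis using 1 2 by simp
qed

text \<open>\<open>\<DD>(c)\<close>, the value of the operator on the word with exponents \<open>c\<close>. The sign \<open>(-1)\<^bsup>#B - 1\<^esup>\<close> is
  written \<open>(-1)\<^bsup>#B + 1\<^esup>\<close>, because \<open>B\<close> may be empty.\<close>

function drop1_exps :: "nat list \<Rightarrow> ncpoly" where
  "drop1_exps c = (if c = [] then 1 else
     (\<Sum>(A, B)\<in>{(A, B). A \<in> P_eo (ones c) \<and> B \<in> P_neo (bigs c) \<and> card A + card B \<ge> 1}.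
        (-1) ^ (card B + 1) * drop1_exps (remove_drop c A B) * gx ^ (card A + card B)) +
     (\<Sum>(A, B)\<in>{(A, B). A \<in> P_eo (ones c) \<and> B \<in> P_neo (bigs c) \<and> card A + card B \<ge> 2}.
        (-1) ^ (card B + 1) * drop1_exps (remove_drop c A B) * z (card A + card B)) +
     (\<Sum>(A, B)\<in>{(A, B). A \<in> P_oe (ones c) \<and> B \<in> P_noe (bigs c) \<and> card A + card B \<ge> 2}.
        (-1) ^ card B * drop1_exps (remove_drop c A B) * z (card A + card B)))"
  by pat_completeness auto
termination
  by (relation "measure sum_list")
    (auto simp: P_eo_def P_oe_def P_neo_def P_noe_def intro!: sum_list_remove_drop)

declare drop1_exps.simps [simp del]

text \<open>The word \<open>y\<^bsup>c\<^sub>1\<^esup>x\<^bsup>c\<^sub>2\<^esup>y\<^bsup>c\<^sub>3\<^esup>x\<^bsup>c\<^sub>4\<^esup>\<cdots>\<close>.\<close>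

fun exps_word :: "nat list \<Rightarrow> letter list" where
  "exps_word (a # b # c) = replicate a Y @ replicate b X @ exps_word c"
| "exps_word [a] = replicate a Y"
| "exps_word [] = []"

definition valid_exps :: "nat list \<Rightarrow> bool" where
  "valid_exps c \<longleftrightarrow> even (length c) \<and> (\<forall>k\<in>set c. k > 0)"

text \<open>Exponents of this kind exist, and are unique, exactly for the words in \<open>H0\<close>, which are the
  empty word and the words that begin with \<open>y\<close> and end with \<open>x\<close>; the domain of the operator is
  \<open>H0\<close>, so its value on other words is irrelevant.\<close>

definition drop1_word :: "letter list \<Rightarrow> ncpoly" where
  "drop1_word w = drop1_exps (THE c. valid_exps c \<and> exps_word c = w)"

definition drop1 :: "ncpoly \<Rightarrow> ncpoly" where
  "drop1 = frag_extend drop1_word"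

lemma replicate_append_eq:
  assumes "replicate m a @ u = replicate n a @ v"
    and "u = [] \<or> hd u \<noteq> a" "v = [] \<or> hd v \<noteq> a"
  shows "m = n \<and> u = v"
  using assms
proof (induction m arbitrary: n)
  case 0
  then show ?case by (cases n) auto
next
  case (Suc m)
  then show ?case by (cases n) auto
qed

lemma valid_exps_Nil: "valid_exps []"
  by (simp add: valid_exps_def)

lemma valid_exps_Cons2: "valid_exps (a # b # c) \<longleftrightarrow> a > 0 \<and> b > 0 \<and> valid_exps c"
  by (auto simp: valid_exps_def)

lemma valid_exps_cases:
  assumes "valid_exps c"
  obtains "c = []" | a b d where "c = a # b # d" "a > 0" "b > 0" "valid_exps d"
proof (cases c rule: exps_word.cases)
  case (1 a b d)
  then show ?thesis using assms that(2) by (simp add: valid_exps_Cons2)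
next
  case (2 a)
  then show ?thesis using assms by (simp add: valid_exps_def)
next
  case 3
  then show ?thesis using that(1) by simp
qed

lemma exps_word_start: "valid_exps c \<Longrightarrow> exps_word c = [] \<or> hd (exps_word c) = Y"
  by (erule valid_exps_cases) auto

lemma exps_word_inj:
  assumes "valid_exps c" "valid_exps d" "exps_word c = exps_word d"
  shows "c = d"
  using assms
proof (induction c arbitrary: d rule: exps_word.induct)
  case (1 a b c)
  have c: "a > 0" "b > 0" "valid_exps c" using 1(2) by (simp_all add: valid_exps_Cons2)
  obtain a' b' d' where d: "d = a' # b' # d'" "a' > 0" "b' > 0" "valid_exps d'"
    using 1(3) by (rule valid_exps_cases) (use 1(4) c in auto)
  have "a = a' \<and> replicate b X @ exps_word c = replicate b' X @ exps_word d'"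
    using 1(4) c d by (intro replicate_append_eq[where a = Y]) auto
  moreover from this have "b = b' \<and> exps_word c = exps_word d'"
    using exps_word_start[OF c(3)] exps_word_start[OF d(4)]
    by (intro replicate_append_eq[where a = X]) auto
  ultimately show ?case using 1(1) c d by simp
next
  case (2 a)
  then show ?case by (simp add: valid_exps_def)
next
  case 3
  from 3(2) show ?case by (rule valid_exps_cases) (use 3(3) in auto)
qed

lemma drop1_exps_word:
  assumes "valid_exps c"
  shows "drop1 (frag_of (exps_word c)) = drop1_exps c"
proof -
  have "(THE d. valid_exps d \<and> exps_word d = exps_word c) = c"
    using assms exps_word_inj by (intro the_equality) auto
  then show ?thesis by (simp add: drop1_def drop1_word_def)
qed

lemma exps_word_exists:
  "w = [] \<or> hd w = Y \<and> last w = X \<Longrightarrow> \<exists>c. valid_exps c \<and> exps_word c = w"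
proof (induction "length w" arbitrary: w rule: less_induct)
  case less
  show ?case
  proof (cases "w = []")
    case True
    then show ?thesis using valid_exps_Nil by (intro exI[of _ "[]"]) simp
  next
    case False
    define u where "u = dropWhile (\<lambda>l. l = Y) w"
    define a where "a = length (takeWhile (\<lambda>l. l = Y) w)"
    define v where "v = dropWhile (\<lambda>l. l = X) u"
    define b where "b = length (takeWhile (\<lambda>l. l = X) u)"
    have "takeWhile (\<lambda>l. l = Y) w = replicate a Y"
      unfolding a_def by (metis (mono_tags, lifting) replicate_length_same set_takeWhileD)
    then have w: "w = replicate a Y @ u" unfolding u_def by (metis takeWhile_dropWhile_id)
    have "takeWhile (\<lambda>l. l = X) u = replicate b X"
      unfolding b_def by (metis (mono_tags, lifting) replicate_length_same set_takeWhileD)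
    then have u: "u = replicate b X @ v" unfolding v_def by (metis takeWhile_dropWhile_id)
    have ends: "hd w = Y" "last w = X" using less(2) False by auto
    have a: "a > 0" using ends(1) False by (cases w) (auto simp: a_def)
    have une: "u \<noteq> []" using ends(2) a w by auto
    then have "hd u \<noteq> Y" unfolding u_def using hd_dropWhile by blast
    then have hdu: "hd u = X" by (cases "hd u") auto
    then have b: "b > 0" using une by (cases u) (auto simp: b_def)
    have "v = [] \<or> hd v = Y \<and> last v = X"
    proof (cases "v = []")
      case False
      then have "hd v \<noteq> X" unfolding v_def using hd_dropWhile by blast
      then have "hd v = Y" by (cases "hd v") auto
      then show ?thesis using ends(2) False w u by auto
    qed simp
    moreover have "length v < length w" using a w u by simp
    ultimately obtain c where "valid_exps c" "exps_word c = v" using less(1) by blast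
    then show ?thesis using a b w u
      by (intro exI[of _ "a # b # c"]) (simp add: valid_exps_Cons2)
  qed
qed

definition shift_stable :: "ncpoly set" where
  "shift_stable = {p. \<forall>n. p * gx ^ n \<in> Hge2}"

text \<open>\<open>drop1\<close> takes its values in \<open>Hge2\<close>.\<close>

lemma drop1_exps_shift_stable: "c = [] \<or> drop1_exps c \<in> shift_stable"
proof (induction c rule: drop1_exps.induct)
  case (1 c)
  note subring = is_subring_hull[of "{z k | k. k \<ge> 2}", folded Hge2_def, unfolded is_subring_def]
  have Hge2: "1 \<in> Hge2" "\<And>a b. a \<in> Hge2 \<Longrightarrow> b \<in> Hge2 \<Longrightarrow> a - b \<in> Hge2"
    "\<And>a b. a \<in> Hge2 \<Longrightarrow> b \<in> Hge2 \<Longrightarrow> a * b \<in> Hge2"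
    using subring by blast+
  have 0: "0 \<in> Hge2" using Hge2(2)[OF Hge2(1) Hge2(1)] by simp
  have zero: "0 \<in> shift_stable" using 0 by (simp add: shift_stable_def)
  have neg: "- a \<in> shift_stable" if "a \<in> shift_stable" for a
    using that Hge2(2)[OF 0] unfolding shift_stable_def by fastforce
  have add: "a + b \<in> shift_stable" if "a \<in> shift_stable" "b \<in> shift_stable" for a b
  proof -
    have "a * gx ^ n - (0 - b * gx ^ n) \<in> Hge2" for n
      using that Hge2(2) 0 unfolding shift_stable_def by blast
    then show ?thesis by (simp add: shift_stable_def algebra_simps)
  qed
  have sums: "sum f S \<in> shift_stable" if "\<And>s. s \<in> S \<Longrightarrow> f s \<in> shift_stable"
    for f and S :: "(int set \<times> int set) set"
    using that by (induction S rule: infinite_finite_induct) (auto intro: zero add)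
  have sign: "(-1) ^ m * a \<in> shift_stable" if "a \<in> shift_stable" for a m
    using that by (cases "even m") (auto intro: neg)
  have z: "a * z k \<in> shift_stable" if "a \<in> Hge2" "k \<ge> 2" for a k
    using that by (auto simp: shift_stable_def mult.assoc z_mult_gx intro!: Hge2(3) z_in_Hge2)
  have gx: "a * gx ^ k \<in> shift_stable" if "a \<in> shift_stable" for a k
    using that by (auto simp: shift_stable_def mult.assoc power_add[symmetric])
  have in_Hge2: "a \<in> Hge2" if "a \<in> shift_stable" for a
    using that unfolding shift_stable_def by (metis (lifting) mem_Collect_eq mult.right_neutral power_0)
  have D_Nil: "drop1_exps [] = 1" by (subst drop1_exps.simps) simp
  show ?case
  proof (cases "c = []")
    case False
    have ne: "remove_drop c A B \<noteq> []" if "A \<in> P_eo (ones c)" for A B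
    proof
      assume "remove_drop c A B = []"
      then have "indices c - A = {}"
        by (simp add: remove_drop_def indices_def)
      moreover have "1 \<in> indices c" using False by (cases c) (auto simp: indices_def)
      ultimately have "1 \<in> A" by blast
      moreover have "(0 \<in> A \<and> even (0::int)) \<longleftrightarrow> (0 + 1 \<in> A \<and> odd (0 + 1 :: int))" "A \<subseteq> ones c"
        using that unfolding P_eo_def by blast+
      ultimately show False by (auto simp: ones_def indices_def)
    qed
    show ?thesis
      unfolding drop1_exps.simps[of c] if_not_P[OF False]
    proof (intro disjI2 add sums)
      fix s assume s: "s \<in> {(A, B). A \<in> P_eo (ones c) \<and> B \<in> P_neo (bigs c) \<and> 1 \<le> card A + card B}"
      obtain A B where [simp]: "s = (A, B)" by (cases s)
      show "(case s of (A, B) \<Rightarrow> (- 1) ^ (card B + 1) * drop1_exps (remove_drop c A B)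
          * gx ^ (card A + card B)) \<in> shift_stable"
        using 1(1)[OF False s] ne s by (simp add: mult.assoc neg sign gx del: power_Suc)
    next
      fix s assume s: "s \<in> {(A, B). A \<in> P_eo (ones c) \<and> B \<in> P_neo (bigs c) \<and> 2 \<le> card A + card B}"
      obtain A B where [simp]: "s = (A, B)" by (cases s)
      have "drop1_exps (remove_drop c A B) \<in> Hge2"
        using 1(2)[OF False s] in_Hge2 Hge2(1) D_Nil by auto
      then show "(case s of (A, B) \<Rightarrow> (- 1) ^ (card B + 1) * drop1_exps (remove_drop c A B)
          * z (card A + card B)) \<in> shift_stable"
        using s by (simp add: mult.assoc neg sign z del: power_Suc)
    next
      fix s assume s: "s \<in> {(A, B). A \<in> P_oe (ones c) \<and> B \<in> P_noe (bigs c) \<and> 2 \<le> card A + card B}"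
      obtain A B where [simp]: "s = (A, B)" by (cases s)
      have "drop1_exps (remove_drop c A B) \<in> Hge2"
        using 1(3)[OF False s] in_Hge2 Hge2(1) D_Nil by auto
      then show "(case s of (A, B) \<Rightarrow> (- 1) ^ card B * drop1_exps (remove_drop c A B)
          * z (card A + card B)) \<in> shift_stable"
        using s by (simp add: mult.assoc sign z)
    qed
  qed simp
qed

lemma drop1_in_Hge2: "drop1 p \<in> Hge2"
  using subset_UNIV[of "Poly_Mapping.keys p"]
proof (induction p rule: frag_induction)
  case zero
  show ?case
    using is_subring_hull[of "{z k | k. k \<ge> 2}", folded Hge2_def]
    unfolding drop1_def is_subring_def by (metis diff_self frag_extend_0)
next
  case (one w)
  have "drop1_exps c \<in> Hge2" for c
  proof (cases "c = []")
    case True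
    then show ?thesis
      using is_subring_hull[of "{z k | k. k \<ge> 2}", folded Hge2_def]
      by (subst drop1_exps.simps) (simp add: is_subring_def)
  next
    case False
    then show ?thesis
      using drop1_exps_shift_stable[of c] unfolding shift_stable_def
      by (metis (lifting) mem_Collect_eq mult.right_neutral power_0)
  qed
  then show ?case by (simp add: drop1_def drop1_word_def)
next
  case (diff a b)
  then show ?case
    using is_subring_hull[of "{z k | k. k \<ge> 2}", folded Hge2_def]
    by (simp add: drop1_def frag_extend_diff is_subring_def)
qed

end

theory Submission
  imports Defs
begin

text \<open>Let \<open>E\<^sub>e\<^sub>o(c)\<close> and \<open>E\<^sub>o\<^sub>e(c)\<close> be the signed sums of all \<open>c\<^sub>(\<^sub>-\<^sub>A\<^sub>) - \<delta>\<^sub>B s\<^bsup>#A + #B\<^esup>\<close> over the two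
  kinds of pairs \<open>(A, B)\<close>. The terms with fewer than two deletions agree, so the recursion for
  \<open>\<DD>\<close>, multiplied on the right by \<open>x\<close>, says that \<open>\<DD>(E\<^sub>e\<^sub>o(c))\<close> with \<open>s\<^sup>k\<close> replaced by \<open>(x + y) x\<^sup>k\<close>
  equals \<open>\<DD>(E\<^sub>o\<^sub>e(c))\<close> with \<open>s\<^sup>k\<close> replaced by \<open>y x\<^sup>k\<close>. This determines \<open>\<DD>\<close>.

  The sets \<open>A\<close>, \<open>B\<close> are chosen independently on the pairs of adjacent positions, so both expansions
  are local. For the word \<open>w\<^sub>1 \<tau>(w\<^sub>2)\<close> they only produce words of the same shape: \<open>E\<^sub>o\<^sub>e\<close> gives
  \<open>\<sigma>(w\<^sub>1) \<tau>(\<sigma>(w\<^sub>2))\<close> with the substitution \<open>\<sigma>(z\<^sub>2) = z\<^sub>2 + s\<^sup>2\<close>, \<open>\<sigma>(z\<^sub>3) = z\<^sub>3 - s z\<^sub>2\<close>, and \<open>E\<^sub>e\<^sub>o\<close> differs from it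
  only at the last factors of \<open>w\<^sub>1\<close> and \<open>w\<^sub>2\<close>. The recursion for \<open>\<star>\<close> yields the same identity
  for \<open>w\<^sub>1 \<star> w\<^sub>2\<close>, because \<open>z\<^sub>2 (x + y) = z\<^sub>2 y + y x\<^sup>2\<close> and
  \<open>z\<^sub>3 (x + y) - z\<^sub>2 (x + y) x = z\<^sub>3 y - z\<^sub>2 y x\<close>.\<close>

section \<open>Sums over deletions\<close>

text \<open>The two parities are treated uniformly: the partner of \<open>i\<close> is \<open>i + 1\<close> when \<open>even i = e\<close>, so \<open>e = True\<close>
  stands for \<open>eo\<close> and \<open>e = False\<close> for \<open>oe\<close>.\<close>

definition pairing :: "bool \<Rightarrow> int set \<Rightarrow> int set set" where
  "pairing e S = {A. A \<subseteq> S \<and> (\<forall>i. even i = e \<longrightarrow> (i \<in> A \<longleftrightarrow> i + 1 \<in> A))}"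

definition unpaired :: "bool \<Rightarrow> int set \<Rightarrow> int set set" where
  "unpaired e S = {A. A \<subseteq> S \<and> (\<forall>i. even i = e \<longrightarrow> \<not> (i \<in> A \<and> i + 1 \<in> A))}"

lemma P_eq_pairing:
  "P_eo S = pairing True S" "P_oe S = pairing False S"
  "P_neo S = unpaired True S" "P_noe S = unpaired False S"
proof -
  have "odd (i + 1) \<longleftrightarrow> even i" "even (i + 1) \<longleftrightarrow> odd i" for i :: int by simp_all
  then show
    "P_eo S = pairing True S" "P_oe S = pairing False S"
    "P_neo S = unpaired True S" "P_noe S = unpaired False S"
    unfolding P_eo_def P_oe_def P_neo_def P_noe_def pairing_def unpaired_def by blast+
qed

definition drops :: "bool \<Rightarrow> nat list \<Rightarrow> (int set \<times> int set) set" where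
  "drops e c = pairing e (ones c) \<times> unpaired e (bigs c)"

text \<open>\<open>F d k\<close> stands for the term \<open>d\<close> times s^k of the signed
  expansion. Leaving \<open>F\<close> arbitrary allows expansions to be nested when a tuple is
  cut.\<close>

definition drop_sum :: "bool \<Rightarrow> nat list \<Rightarrow> (nat list \<Rightarrow> nat \<Rightarrow> 'a::ring_1) \<Rightarrow> 'a" where
  "drop_sum e c F =
     (\<Sum>(A, B)\<in>drops e c. (-1) ^ card B * F (remove_drop c A B) (card A + card B))"

lemma finite_indices: "finite (indices c)"
  by (simp add: indices_def)

lemma drops_subset: "(A, B) \<in> drops e c \<Longrightarrow> A \<subseteq> ones c \<and> B \<subseteq> bigs c"
  by (auto simp: drops_def pairing_def unpaired_def)

lemma drops_finite:
  assumes "(A, B) \<in> drops e c"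
  shows "finite A" "finite B"
  using drops_subset[OF assms] finite_subset[OF _ finite_indices[of c]]
  by (auto simp: ones_def bigs_def)

lemma finite_drops: "finite (drops e c)"
proof (rule finite_subset)
  show "drops e c \<subseteq> Pow (indices c) \<times> Pow (indices c)"
    using drops_subset by (fastforce simp: ones_def bigs_def)
qed (simp add: finite_indices)

lemma empty_in_drops: "({}, {}) \<in> drops e c"
  by (simp add: drops_def pairing_def unpaired_def)

lemma remove_drop_empty: "remove_drop c {} {} = c"
proof -
  have *: "sorted_list_of_set (indices c) = [1..int (length c)]"
    by (simp add: indices_def)
  show ?thesis
    unfolding remove_drop_def Diff_empty *
    by (rule nth_equalityI) (simp_all add: entry_def)
qed

lemma remove_drop_filter:
  "remove_drop c A B = map (\<lambda>i. entry c i - (if i \<in> B then 1 else 0))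
     (filter (\<lambda>i. i \<notin> A) [1..int (length c)])"
proof -
  have "sorted_list_of_set (indices c - A) = filter (\<lambda>i. i \<notin> A) [1..int (length c)]"
    by (rule sorted_distinct_set_unique)
      (auto simp: indices_def intro: sorted_wrt_filter distinct_filter)
  then show ?thesis by (simp add: remove_drop_def)
qed

section \<open>Deletions in a concatenation\<close>

lemma indices_append:
  "indices (u @ d) = indices u \<union> (+) (int (length u)) ` indices d"
proof (intro equalityI subsetI)
  fix i assume i: "i \<in> indices (u @ d)"
  show "i \<in> indices u \<union> (+) (int (length u)) ` indices d"
  proof (cases "i \<le> int (length u)")
    case True
    then show ?thesis using i by (simp add: indices_def)
  next
    case False
    then have "i - int (length u) \<in> indices d" using i by (simp add: indices_def)
    then show ?thesis by (intro UnI2 image_eqI[of _ _ "i - int (length u)"]) auto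
  qed
qed (auto simp: indices_def)

lemma entry_append:
  "i \<in> indices u \<Longrightarrow> entry (u @ d) i = entry u i"
  "i \<in> indices d \<Longrightarrow> entry (u @ d) (int (length u) + i) = entry d i"
proof -
  show "i \<in> indices u \<Longrightarrow> entry (u @ d) i = entry u i"
    by (auto simp: indices_def entry_def nth_append)
  assume i: "i \<in> indices d"
  then have "nat (int (length u) + i - 1) = length u + nat (i - 1)"
    by (auto simp: indices_def)
  then show "entry (u @ d) (int (length u) + i) = entry d i"
    by (simp add: entry_def)
qed

lemma ones_append: "ones (u @ d) = ones u \<union> (+) (int (length u)) ` ones d"
  by (auto simp: ones_def indices_append entry_append)

lemma bigs_append: "bigs (u @ d) = bigs u \<union> (+) (int (length u)) ` bigs d"
  by (auto simp: bigs_def indices_append entry_append)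

lemma remove_drop_append:
  assumes "A \<subseteq> indices u" "B \<subseteq> indices u" "A' \<subseteq> indices d" "B' \<subseteq> indices d"
  shows "remove_drop (u @ d) (A \<union> (+) (int (length u)) ` A') (B \<union> (+) (int (length u)) ` B')
    = remove_drop u A B @ remove_drop d A' B'"
proof -
  let ?n = "int (length u)"
  have shift: "map ((+) ?n) [1..int (length d)] = [?n + 1..?n + int (length d)]"
    by (rule nth_equalityI) auto
  have split: "[1..int (length (u @ d))] = [1..?n] @ map ((+) ?n) [1..int (length d)]"
    unfolding shift by (cases "d = []") (simp, subst upto_split1[of 1 "?n + 1"], auto simp: Suc_le_eq)
  have "i \<in> A \<union> (+) ?n ` A' \<longleftrightarrow> i \<in> A" "i \<in> B \<union> (+) ?n ` B' \<longleftrightarrow> i \<in> B"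
    if "i \<in> indices u" for i
    using that assms(3,4) by (auto simp: indices_def)
  moreover have "?n + i \<in> A \<union> (+) ?n ` A' \<longleftrightarrow> i \<in> A'" "?n + i \<in> B \<union> (+) ?n ` B' \<longleftrightarrow> i \<in> B'"
    if "i \<in> indices d" for i
    using that assms(1,2) by (auto simp: indices_def)
  moreover have "set [1..?n] = indices u" "set [1..int (length d)] = indices d"
    by (auto simp: indices_def)
  ultimately show ?thesis
    unfolding remove_drop_filter split filter_append map_append filter_map map_map
    by (intro arg_cong2[of _ _ _ _ "(@)"] map_cong filter_cong)
      (auto simp: entry_append)
qed

lemma subset_split:
  fixes n :: int
  assumes "S \<subseteq> {..n}" "S' \<subseteq> {1..}"
  shows "A \<subseteq> S \<union> (+) n ` S' \<longleftrightarrow> A \<inter> {..n} \<subseteq> S \<and> {i. i \<ge> 1 \<and> n + i \<in> A} \<subseteq> S'"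
proof -
  have "i \<in> S \<union> (+) n ` S' \<longleftrightarrow> (if i \<le> n then i \<in> S else i - n \<in> S')" for i
  proof -
    have "i \<in> (+) n ` S' \<longleftrightarrow> i - n \<in> S'" by (auto simp: image_iff intro: bexI[of _ "i - n"])
    then show ?thesis using assms by auto
  qed
  then have "A \<subseteq> S \<union> (+) n ` S' \<longleftrightarrow> (\<forall>i\<in>A. if i \<le> n then i \<in> S else i - n \<in> S')"
    by blast
  also have "\<dots> \<longleftrightarrow> A \<inter> {..n} \<subseteq> S \<and> {i. i \<ge> 1 \<and> n + i \<in> A} \<subseteq> S'"
  proof (intro iffI conjI ballI)
    fix i assume "A \<inter> {..n} \<subseteq> S \<and> {i. i \<ge> 1 \<and> n + i \<in> A} \<subseteq> S'" "i \<in> A"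
    moreover from this have "i > n \<Longrightarrow> i - n \<in> {i. i \<ge> 1 \<and> n + i \<in> A}" by simp
    ultimately show "if i \<le> n then i \<in> S else i - n \<in> S'" by auto
  qed fastforce+
  finally show ?thesis .
qed

text \<open>The cut after position \<open>n\<close> separates no pair; the second part starts a new pair.\<close>

lemma pairing_split:
  fixes n :: int
  assumes "even n \<noteq> e" "S \<subseteq> {..n}" "S' \<subseteq> {1..}"
  shows "A \<in> pairing e (S \<union> (+) n ` S') \<longleftrightarrow>
    A \<inter> {..n} \<in> pairing e S \<and> {i. i \<ge> 1 \<and> n + i \<in> A} \<in> pairing False S'"
proof -
  have "(\<forall>i. even i = e \<longrightarrow> (i \<in> A \<longleftrightarrow> i + 1 \<in> A)) \<longleftrightarrow>
    (\<forall>i. even i = e \<longrightarrow> (i \<in> A \<inter> {..n} \<longleftrightarrow> i + 1 \<in> A \<inter> {..n})) \<and>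
    (\<forall>i. even i = False \<longrightarrow>
      (i \<in> {i. i \<ge> 1 \<and> n + i \<in> A} \<longleftrightarrow> i + 1 \<in> {i. i \<ge> 1 \<and> n + i \<in> A}))" (is "?l \<longleftrightarrow> ?r1 \<and> ?r2")
  proof
    assume l: ?l
    show "?r1 \<and> ?r2"
    proof (intro conjI allI impI)
      fix i :: int assume i: "even i = e"
      have "i \<noteq> n" using assms(1) i by auto
      then have "i \<le> n \<longleftrightarrow> i + 1 \<le> n" by linarith
      moreover have "i \<in> A \<longleftrightarrow> i + 1 \<in> A" using l i by blast
      ultimately show "i \<in> A \<inter> {..n} \<longleftrightarrow> i + 1 \<in> A \<inter> {..n}" by simp
    next
      fix i :: int assume i: "even i = False"
      \<comment> \<open>Since \<open>even n \<noteq> e\<close>, adding \<open>n\<close> carries the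
        odd positions to those of parity \<open>e\<close>, so pairs go to pairs. An odd
        \<open>i\<close> is not 0, so the bound at 1 cuts no pair.\<close>
      have "i \<noteq> 0" "even (n + i) = e" using assms(1) i by auto
      then have "i \<ge> 1 \<longleftrightarrow> i + 1 \<ge> 1" "n + i \<in> A \<longleftrightarrow> n + i + 1 \<in> A"
        using l by (linarith, blast)
      then show "i \<in> {i. i \<ge> 1 \<and> n + i \<in> A} \<longleftrightarrow> i + 1 \<in> {i. i \<ge> 1 \<and> n + i \<in> A}"
        unfolding mem_Collect_eq add.assoc by blast
    qed
  next
    assume r: "?r1 \<and> ?r2"
    show ?l
    proof (intro allI impI)
      fix i :: int assume i: "even i = e"
      have "i \<noteq> n" using assms(1) i by auto
      show "i \<in> A \<longleftrightarrow> i + 1 \<in> A"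
      proof (cases "i < n")
        case True
        moreover have "i \<in> A \<inter> {..n} \<longleftrightarrow> i + 1 \<in> A \<inter> {..n}" using r i by blast
        ultimately show ?thesis by simp
      next
        case False
        have "even (i - n) = False" using assms(1) i by auto
        then have "i - n \<in> {i. i \<ge> 1 \<and> n + i \<in> A} \<longleftrightarrow> i - n + 1 \<in> {i. i \<ge> 1 \<and> n + i \<in> A}"
          using r by blast
        then show ?thesis using False \<open>i \<noteq> n\<close> by (simp add: add.assoc[symmetric])
      qed
    qed
  qed
  then show ?thesis
    unfolding pairing_def mem_Collect_eq subset_split[OF assms(2,3)] by argo
qed

lemma unpaired_split:
  fixes n :: int
  assumes "even n \<noteq> e" "S \<subseteq> {..n}" "S' \<subseteq> {1..}"
  shows "A \<in> unpaired e (S \<union> (+) n ` S') \<longleftrightarrow>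
    A \<inter> {..n} \<in> unpaired e S \<and> {i. i \<ge> 1 \<and> n + i \<in> A} \<in> unpaired False S'"
proof -
  have "(\<forall>i. even i = e \<longrightarrow> \<not> (i \<in> A \<and> i + 1 \<in> A)) \<longleftrightarrow>
    (\<forall>i. even i = e \<longrightarrow> \<not> (i \<in> A \<inter> {..n} \<and> i + 1 \<in> A \<inter> {..n})) \<and>
    (\<forall>i. even i = False \<longrightarrow>
      \<not> (i \<in> {i. i \<ge> 1 \<and> n + i \<in> A} \<and> i + 1 \<in> {i. i \<ge> 1 \<and> n + i \<in> A}))" (is "?l \<longleftrightarrow> ?r1 \<and> ?r2")
  proof (intro iffI conjI allI impI)
    fix i :: int assume l: ?l and i: "even i = False"
    have "even (n + i) = e" using assms(1) i by auto
    then show "\<not> (i \<in> {i. i \<ge> 1 \<and> n + i \<in> A} \<and> i + 1 \<in> {i. i \<ge> 1 \<and> n + i \<in> A})"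
      using l by (auto simp: add.assoc[symmetric])
  next
    fix i :: int assume r: "?r1 \<and> ?r2" and i: "even i = e"
    have "i \<noteq> n" using assms(1) i by auto
    show "\<not> (i \<in> A \<and> i + 1 \<in> A)"
    proof (cases "i < n")
      case True
      then show ?thesis using r i by auto
    next
      case False
      have "even (i - n) = False" using assms(1) i by auto
      then have "\<not> (i - n \<in> {i. i \<ge> 1 \<and> n + i \<in> A} \<and> i - n + 1 \<in> {i. i \<ge> 1 \<and> n + i \<in> A})"
        using r by blast
      then show ?thesis using False \<open>i \<noteq> n\<close> by (auto simp: add.assoc[symmetric])
    qed
  qed auto
  then show ?thesis
    unfolding unpaired_def mem_Collect_eq subset_split[OF assms(2,3)] by argo
qed

text \<open>By the parity hypothesis no pair straddles the cut, so the choices on both sides are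
  independent: signs multiply and deletion counts add. The second part starts a pair, hence always
  carries \<open>False\<close>.\<close>

lemma drop_sum_append:
  assumes "even (length u) \<noteq> e"
  shows "drop_sum e (u @ d) F =
    drop_sum e u (\<lambda>v k. drop_sum False d (\<lambda>w l. F (v @ w) (k + l)))"
proof -
  let ?n = "int (length u)"
  define low :: "int set \<Rightarrow> int set" where "low A = A \<inter> {..?n}" for A
  define high :: "int set \<Rightarrow> int set" where "high A = {i. i \<ge> 1 \<and> ?n + i \<in> A}" for A
  define join :: "int set \<Rightarrow> int set \<Rightarrow> int set" where "join A A' = A \<union> (+) ?n ` A'" for A A'
  have n: "even ?n \<noteq> e" using assms by simp
  have sub: "ones u \<subseteq> {..?n}" "bigs u \<subseteq> {..?n}" "ones d \<subseteq> {1..}" "bigs d \<subseteq> {1..}"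
    by (auto simp: ones_def bigs_def indices_def)
  have split: "(A, B) \<in> drops e (u @ d) \<longleftrightarrow>
      (low A, low B) \<in> drops e u \<and> (high A, high B) \<in> drops False d" for A B
    unfolding drops_def mem_Sigma_iff ones_append bigs_append low_def high_def
      pairing_split[OF n sub(1,3)] unpaired_split[OF n sub(2,4)] by blast
  have join_split: "join (low A) (high A) = A" for A
  proof (intro equalityI subsetI)
    fix i assume i: "i \<in> A"
    show "i \<in> join (low A) (high A)"
    proof (cases "i \<le> ?n")
      case False
      then have "i - ?n \<in> high A" using i by (simp add: high_def)
      then show ?thesis unfolding join_def by (intro UnI2 image_eqI[of _ _ "i - ?n"]) auto
    qed (use i in \<open>simp add: join_def low_def\<close>)
  qed (auto simp: join_def low_def high_def)
  have low_join: "low (join A A') = A" and high_join: "high (join A A') = A'"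
    if "A \<subseteq> indices u" "A' \<subseteq> indices d" for A A'
    using that by (fastforce simp: low_def high_def join_def indices_def)+
  have sub': "A \<subseteq> indices c \<and> B \<subseteq> indices c" if "(A, B) \<in> drops e c" for A B e c
    using drops_subset[OF that] by (auto simp: ones_def bigs_def)
  have card_join: "card (join A A') = card A + card A'"
    if "A \<subseteq> indices u" "A' \<subseteq> indices d" for A A'
  proof -
    have "finite A" "finite A'" using that finite_indices finite_subset by blast+
    moreover have "A \<inter> (+) ?n ` A' = {}" using that by (fastforce simp: indices_def)
    ultimately show ?thesis by (simp add: join_def card_Un_disjoint card_image)
  qed
  have "drop_sum e u (\<lambda>v k. drop_sum False d (\<lambda>w l. F (v @ w) (k + l))) =
    (\<Sum>((A, B), (A', B'))\<in>drops e u \<times> drops False d. (-1) ^ card B * ((-1) ^ card B' *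
      F (remove_drop u A B @ remove_drop d A' B') (card A + card B + (card A' + card B'))))"
    unfolding drop_sum_def sum_distrib_left sum.cartesian_product[symmetric]
    by (simp add: case_prod_beta sum_distrib_left)
  also have "\<dots> = drop_sum e (u @ d) F"
    unfolding drop_sum_def
  proof (rule sum.reindex_bij_witness[where
        j = "\<lambda>((A, B), (A', B')). (join A A', join B B')" and
        i = "\<lambda>(A, B). ((low A, low B), (high A, high B))"], goal_cases)
    case (1 x)
    then show ?case by (auto simp: low_join high_join dest!: sub')
  next
    case (2 x)
    then obtain A B A' B' where x: "x = ((A, B), (A', B'))" "(A, B) \<in> drops e u"
      "(A', B') \<in> drops False d" by auto
    then show ?case using sub'[OF x(2)] sub'[OF x(3)] by (simp add: split low_join high_join)
  next
    case (3 x)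
    then show ?case by (cases x) (simp add: join_split)
  next
    case (4 x)
    then show ?case by (cases x) (simp add: split)
  next
    case (5 x)
    then obtain A B A' B' where x: "x = ((A, B), (A', B'))" "(A, B) \<in> drops e u"
      "(A', B') \<in> drops False d" by auto
    note s = sub'[OF x(2)] sub'[OF x(3)]
    have "remove_drop (u @ d) (join A A') (join B B') = remove_drop u A B @ remove_drop d A' B'"
      using s unfolding join_def by (intro remove_drop_append) auto
    then show ?case using s
      by (simp add: x(1) card_join power_add mult.assoc add_ac minus_one_power_iff)
  qed
  finally show ?thesis by simp
qed

section \<open>Tuples of length at most two\<close>

lemma pairing_small:
  "pairing e {} = {{}}" "pairing e {1} = {{}}" "pairing e {2} = {{}}"
  "pairing False {1, 2} = {{}, {1, 2}}"
proof -
  show "pairing e {} = {{}}" by (auto simp: pairing_def)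
  have empty: "{} \<in> pairing e S" for e S by (simp add: pairing_def)
  have "A = {}" if A: "A \<in> pairing e {j}" for A j
  proof (rule ccontr)
    assume "A \<noteq> {}"
    then have "A = {j}" using A unfolding pairing_def by blast
    \<comment> \<open>Every integer is the lower or the upper member of exactly one pair, so
      \<open>A\<close> would also contain the partner of \<open>j\<close>.\<close>
    moreover have "even j = e \<longrightarrow> (j \<in> A \<longleftrightarrow> j + 1 \<in> A)"
      "even (j - 1) = e \<longrightarrow> (j - 1 \<in> A \<longleftrightarrow> j - 1 + 1 \<in> A)"
      using A unfolding pairing_def by blast+
    ultimately show False by (cases "even j = e") simp_all
  qed
  then show "pairing e {1} = {{}}" "pairing e {2} = {{}}" using empty by blast+
  show "pairing False {1, 2} = {{}, {1, 2}}"
  proof (intro equalityI subsetI)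
    fix A assume "A \<in> pairing False {1, 2}"
    then have "A \<subseteq> {1, 2}" "odd (1 :: int) \<longrightarrow> (1 \<in> A \<longleftrightarrow> 1 + 1 \<in> A)"
      unfolding pairing_def by blast+
    then show "A \<in> {{}, {1, 2}}" by auto
  next
    have "i \<in> {1, 2} \<longleftrightarrow> i + 1 \<in> {1, 2}" if "odd i" for i :: int
    proof -
      have "i \<noteq> 0" "i \<noteq> 2" using that by auto
      then show ?thesis by auto
    qed
    then have "{1, 2} \<in> pairing False {1, 2}" by (simp add: pairing_def)
    moreover fix A :: "int set" assume "A \<in> {{}, {1, 2}}"
    ultimately show "A \<in> pairing False {1, 2}" using empty by blast
  qed
qed

lemma unpaired_small:
  "unpaired e {} = {{}}" "unpaired e {1} = {{}, {1}}" "unpaired e {2} = {{}, {2}}"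
  "unpaired False {1, 2} = {{}, {1}, {2}}"
proof -
  show "unpaired e {} = {{}}" by (auto simp: unpaired_def)
  show "unpaired e {1} = {{}, {1}}" "unpaired e {2} = {{}, {2}}"
    by (auto simp: unpaired_def)
  show "unpaired False {1, 2} = {{}, {1}, {2}}"
  proof (intro equalityI subsetI)
    fix A assume "A \<in> unpaired False {1, 2}"
    then have "A \<subseteq> {1, 2}" "odd (1 :: int) \<longrightarrow> \<not> (1 \<in> A \<and> 1 + 1 \<in> A)"
      unfolding unpaired_def by blast+
    then show "A \<in> {{}, {1}, {2}}" by auto
  qed (auto simp: unpaired_def)
qed

lemma ones_bigs_small:
  "ones [] = {}" "bigs [] = {}"
  "ones [1] = {1}" "bigs [1] = {}" "ones [2] = {}" "bigs [2] = {1}"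
  "ones [1, 1] = {1, 2}" "bigs [1, 1] = {}" "ones [1, 2] = {1}" "bigs [1, 2] = {2}"
  "ones [2, 1] = {2}" "bigs [2, 1] = {1}" "ones [2, 2] = {}" "bigs [2, 2] = {1, 2}"
proof -
  have 1: "indices [] = {}" "indices [a] = {1}" "indices [a, b] = {1, 2}" for a b
    by (auto simp: indices_def)
  have 2: "entry [a] 1 = a" "entry [a, b] 1 = a" "entry [a, b] 2 = b" for a b
    by (simp_all add: entry_def)
  show
    "ones [] = {}" "bigs [] = {}"
    "ones [1] = {1}" "bigs [1] = {}" "ones [2] = {}" "bigs [2] = {1}"
    "ones [1, 1] = {1, 2}" "bigs [1, 1] = {}" "ones [1, 2] = {1}" "bigs [1, 2] = {2}"
    "ones [2, 1] = {2}" "bigs [2, 1] = {1}" "ones [2, 2] = {}" "bigs [2, 2] = {1, 2}"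
    unfolding ones_def bigs_def by (auto simp: 1 2)
qed

text \<open>These blocks suffice, because all exponents of w_1 \<tau>(w_2) are 1 or 2. A 1 can only
  disappear together with an adjacent 1 paired with it; a 2 can be lowered, but not both members of
  a pair.\<close>

lemma drop_sum_small:
  "drop_sum e [] F = F [] 0"
  "drop_sum e [1] F = F [1] 0"
  "drop_sum e [2] F = F [2] 0 - F [1] 1"
  "drop_sum False [1, 1] F = F [1, 1] 0 + F [] 2"
  "drop_sum False [1, 2] F = F [1, 2] 0 - F [1, 1] 1"
  "drop_sum False [2, 1] F = F [2, 1] 0 - F [1, 1] 1"
  "drop_sum False [2, 2] F = F [2, 2] 0 - F [1, 2] 1 - F [2, 1] 1"
proof -
  have u: "[1..2::int] = [1, 2]" by (simp add: upto.simps)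
  show
    "drop_sum e [] F = F [] 0"
    "drop_sum e [1] F = F [1] 0"
    "drop_sum e [2] F = F [2] 0 - F [1] 1"
    "drop_sum False [1, 1] F = F [1, 1] 0 + F [] 2"
    "drop_sum False [1, 2] F = F [1, 2] 0 - F [1, 1] 1"
    "drop_sum False [2, 1] F = F [2, 1] 0 - F [1, 1] 1"
    "drop_sum False [2, 2] F = F [2, 2] 0 - F [1, 2] 1 - F [2, 1] 1"
    unfolding drop_sum_def drops_def ones_bigs_small pairing_small unpaired_small
    by (simp_all add: remove_drop_filter entry_def u numeral_2_eq_2)
qed

section \<open>The recursion for the drop 1 operator\<close>

text \<open>A nonempty \<open>A\<close> contains a whole pair, and a set \<open>B\<close> with at
  most one element contains none. Hence the right-hand side is independent of
  \<open>e\<close>.\<close>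

lemma drops_few_deletions:
  "{(A, B)\<in>drops e c. card A + card B < 2} = {({}, B) | B. B \<subseteq> bigs c \<and> card B < 2}"
proof (intro equalityI subsetI)
  fix x assume "x \<in> {(A, B)\<in>drops e c. card A + card B < 2}"
  then obtain A B where x: "x = (A, B)" "(A, B) \<in> drops e c" "card A + card B < 2" by blast
  have "A = {}"
  proof (rule ccontr)
    assume "A \<noteq> {}"
    then obtain i where i: "i \<in> A" by blast
    have "even i = e \<longrightarrow> (i \<in> A \<longleftrightarrow> i + 1 \<in> A)"
      "even (i - 1) = e \<longrightarrow> (i - 1 \<in> A \<longleftrightarrow> i - 1 + 1 \<in> A)"
      using x(2) unfolding drops_def pairing_def by blast+
    then obtain j where j: "j \<in> A" "j \<noteq> i" using i by (cases "even i = e") force+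
    then have "card {i, j} \<le> card A"
      using i drops_finite[OF x(2)] by (intro card_mono) auto
    then show False using x(3) j by simp
  qed
  then show "x \<in> {({}, B) | B. B \<subseteq> bigs c \<and> card B < 2}"
    using x drops_subset[OF x(2)] by auto
next
  fix x :: "int set \<times> int set"
  assume "x \<in> {({}, B) | B. B \<subseteq> bigs c \<and> card B < 2}"
  then obtain B where x: "x = ({}, B)" "B \<subseteq> bigs c" "card B < 2" by blast
  have fin: "finite B"
    using x(2) finite_subset[OF _ finite_indices[of c]] by (auto simp: bigs_def)
  have "\<not> (i \<in> B \<and> i + 1 \<in> B)" for i
  proof
    assume "i \<in> B \<and> i + 1 \<in> B"
    then have "card {i, i + 1} \<le> card B" using fin by (intro card_mono) auto
    then show False using x(3) by simp
  qed
  then show "x \<in> {(A, B)\<in>drops e c. card A + card B < 2}"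
    using x by (simp add: drops_def pairing_def unpaired_def)
qed

lemma drop1_exps_drop_sum:
  assumes "c \<noteq> []"
  shows "drop_sum True c (\<lambda>d k. drop1_exps d * (gx + gy) * gx ^ k) =
    drop_sum False c (\<lambda>d k. drop1_exps d * gy * gx ^ k)"
proof -
  define t where "t A B = (-1) ^ card B * drop1_exps (remove_drop c A B)" for A B
  \<comment> \<open>The recursion starts its sums at one and at two deletions, so the sums are
    truncated by a condition \<open>P\<close> on their number.\<close>
  define S where "S e P h = (\<Sum>(A, B)\<in>{(A, B)\<in>drops e c. P (card A + card B)}.
    t A B * h (card A + card B))" for e and P :: "nat \<Rightarrow> bool" and h :: "nat \<Rightarrow> ncpoly"
  have all: "drop_sum e c (\<lambda>d k. drop1_exps d * h k) = S e (\<lambda>_. True) h" for e h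
    by (simp add: drop_sum_def S_def t_def mult.assoc case_prod_beta)
  have split: "S e (\<lambda>_. True) h = S e (\<lambda>n. n < m) h + S e (\<lambda>n. n \<ge> m) h" for e h m
  proof -
    have "drops e c = {(A, B)\<in>drops e c. card A + card B < m} \<union>
      {(A, B)\<in>drops e c. card A + card B \<ge> m}" by auto
    then show ?thesis
      unfolding S_def using finite_drops[of e c]
      by (subst sum.union_disjoint[symmetric]) (auto intro: finite_subset)
  qed
  have "{(A, B)\<in>drops e c. card A + card B < 1} = {({}, {})}" for e
    using empty_in_drops[of e c] drops_finite[of _ _ e c] by auto
  then have first: "S True (\<lambda>n. n < 1) h = drop1_exps c * h 0" for h
    by (simp add: S_def t_def remove_drop_empty)
  have low: "S True (\<lambda>n. n < 2) h = S False (\<lambda>n. n < 2) h" for h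
    unfolding S_def drops_few_deletions ..
  have z: "S e (\<lambda>n. n \<ge> 2) z * gx = S e (\<lambda>n. n \<ge> 2) (\<lambda>k. gy * gx ^ k)" for e
    unfolding S_def sum_distrib_right
  proof (rule sum.cong[OF refl], clarify)
    fix A B :: "int set" assume "2 \<le> card A + card B"
    then show "t A B * z (card A + card B) * gx = t A B * (gy * gx ^ (card A + card B))"
      using z_mult_gx[of "card A + card B" 1] by (simp add: z_def mult.assoc)
  qed
  \<comment> \<open>The signs come from (-1)^(#B + 1) in the recursion against (-1)^#B in
    \<open>t\<close>. Moving the first sum to the left supplies the missing term without
    deletions.\<close>
  have "drop1_exps c = - S True (\<lambda>n. n \<ge> 1) (\<lambda>k. gx ^ k) - S True (\<lambda>n. n \<ge> 2) z
      + S False (\<lambda>n. n \<ge> 2) z"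
  proof -
    have "{(A, B). A \<in> pairing e (ones c) \<and> B \<in> unpaired e (bigs c) \<and> P (card A + card B)}
      = {(A, B)\<in>drops e c. P (card A + card B)}" for e P
      by (auto simp: drops_def)
    then show ?thesis
      by (subst drop1_exps.simps)
        (simp add: assms P_eq_pairing S_def t_def sum_negf[symmetric] case_prod_beta mult.assoc)
  qed
  moreover have "S True (\<lambda>_. True) (\<lambda>k. gx ^ k) = drop1_exps c + S True (\<lambda>n. n \<ge> 1) (\<lambda>k. gx ^ k)"
    using split[of True _ 1] first by simp
  ultimately have "S True (\<lambda>_. True) (\<lambda>k. gx ^ k) = S False (\<lambda>n. n \<ge> 2) z - S True (\<lambda>n. n \<ge> 2) z"
    by simp
  then have "S True (\<lambda>_. True) (\<lambda>k. gx ^ k) * gx =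
      S False (\<lambda>n. n \<ge> 2) (\<lambda>k. gy * gx ^ k) - S True (\<lambda>n. n \<ge> 2) (\<lambda>k. gy * gx ^ k)"
    by (simp add: left_diff_distrib z)
  \<comment> \<open>By \<open>low\<close>, the terms with fewer than two deletions can be added to
    both sums and cancel.\<close>
  also have "\<dots> = S False (\<lambda>_. True) (\<lambda>k. gy * gx ^ k) - S True (\<lambda>_. True) (\<lambda>k. gy * gx ^ k)"
    by (simp add: split[of _ _ 2] low)
  finally have "S True (\<lambda>_. True) (\<lambda>k. gx ^ k) * gx + S True (\<lambda>_. True) (\<lambda>k. gy * gx ^ k)
      = S False (\<lambda>_. True) (\<lambda>k. gy * gx ^ k)"
    by simp
  moreover have "S True (\<lambda>_. True) (\<lambda>k. gx ^ k) * gx + S True (\<lambda>_. True) (\<lambda>k. gy * gx ^ k)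
      = S True (\<lambda>_. True) (\<lambda>k. (gx + gy) * gx ^ k)"
    unfolding S_def
    by (simp add: sum_distrib_right sum.distrib[symmetric] case_prod_beta algebra_simps
        power_commutes)
  ultimately show ?thesis by (simp add: all mult.assoc)
qed

section \<open>Deletions in \<open>w\<^sub>1 \<tau>(w\<^sub>2)\<close>\<close>

text \<open>A monomial in \<open>z\<^sub>2\<close> and \<open>z\<^sub>3\<close> is a list of booleans, last factor first, with \<open>True\<close> for \<open>z\<^sub>3\<close>.\<close>

fun rev_word :: "bool list \<Rightarrow> letter list" where
  "rev_word [] = []"
| "rev_word (False # p) = X # Y # rev_word p"
| "rev_word (True # p) = X # X # Y # rev_word p"

definition xexp :: "bool \<Rightarrow> nat" where
  "xexp b = (if b then 2 else 1)"

text \<open>\<open>exps_left p\<close> belongs to the monomial \<open>p\<close>,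
  \<open>exps_right q\<close> to the image of \<open>q\<close> under \<tau>, which reverses the
  factors and takes y x^m to y^m x.\<close>

definition exps_left :: "bool list \<Rightarrow> nat list" where
  "exps_left p = concat (map (\<lambda>b. [1, xexp b]) (rev p))"

definition exps_right :: "bool list \<Rightarrow> nat list" where
  "exps_right q = concat (map (\<lambda>b. [xexp b, 1]) q)"

text \<open>The expansion of a monomial under \<open>z\<^sub>2 \<mapsto> z\<^sub>2 + s\<^sup>2\<close>, \<open>z\<^sub>3 \<mapsto> z\<^sub>3 - s z\<^sub>2\<close>, with \<open>F r k\<close> in place of
  \<open>r s\<^sup>k\<close>.\<close>

fun zsum :: "bool list \<Rightarrow> (bool list \<Rightarrow> nat \<Rightarrow> 'a::ring_1) \<Rightarrow> 'a" where
  "zsum [] F = F [] 0"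
| "zsum (False # p) F = zsum p (\<lambda>r k. F (False # r) k + F r (k + 2))"
| "zsum (True # p) F = zsum p (\<lambda>r k. F (True # r) k - F (False # r) (k + 1))"

text \<open>The expansions \<open>E\<^sub>o\<^sub>e\<close> and \<open>E\<^sub>e\<^sub>o\<close> of \<open>w\<^sub>1 \<tau>(w\<^sub>2)\<close>, with \<open>F r r' k\<close> in place of \<open>r \<tau>(r') s\<^sup>k\<close>. In \<open>eo_sum\<close>
  the heads of the lists are the last factors, whose exponents meet in the middle of the word.\<close>

definition oe_sum :: "bool list \<Rightarrow> bool list \<Rightarrow> (bool list \<Rightarrow> bool list \<Rightarrow> nat \<Rightarrow> 'a::ring_1) \<Rightarrow> 'a" where
  "oe_sum p q F = zsum p (\<lambda>r k. zsum q (\<lambda>r' l. F r r' (k + l)))"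

fun eo_sum :: "bool list \<Rightarrow> bool list \<Rightarrow> (bool list \<Rightarrow> bool list \<Rightarrow> nat \<Rightarrow> 'a::ring_1) \<Rightarrow> 'a" where
  "eo_sum [] [] F = F [] [] 0"
| "eo_sum (b # p) [] F =
     zsum p (\<lambda>r k. F (b # r) [] k - (if b then F (False # r) [] (k + 1) else 0))"
| "eo_sum [] (a # q) F =
     zsum q (\<lambda>r k. F [] (a # r) k - (if a then F [] (False # r) (k + 1) else 0))"
| "eo_sum (b # p) (a # q) F = zsum p (\<lambda>r k. zsum q (\<lambda>r' l.
     F (b # r) (a # r') (k + l)
     - (if b then F (False # r) (a # r') (k + l + 1) else 0)
     - (if a then F (b # r) (False # r') (k + l + 1) else 0)
     + (if a \<or> b then 0 else F (False # r) r' (k + l + 2))))"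

lemma zsum_add: "zsum p F + zsum p G = zsum p (\<lambda>r k. F r k + G r k)"
proof (induction p arbitrary: F G)
  case (Cons b p)
  then show ?case by (cases b) (simp_all, simp_all add: algebra_simps)
qed simp

lemma zsum_diff: "zsum p F - zsum p G = zsum p (\<lambda>r k. F r k - G r k)"
proof (induction p arbitrary: F G)
  case (Cons b p)
  then show ?case by (cases b) (simp_all, simp_all add: algebra_simps)
qed simp

section \<open>Expansion of the exponent tuples\<close>

lemma exps_left_simps: "exps_left [] = []" "exps_left (b # p) = exps_left p @ [1, xexp b]"
  by (simp_all add: exps_left_def)

lemma exps_right_simps: "exps_right [] = []" "exps_right (b # q) = [xexp b, 1] @ exps_right q"
  by (simp_all add: exps_right_def)

lemma drop_sum_even_prefix:
  "drop_sum False ([a, b] @ d) F =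
    drop_sum False [a, b] (\<lambda>v k. drop_sum False d (\<lambda>w l. F (v @ w) (k + l)))"
  by (rule drop_sum_append) simp

lemma drop_sum_odd_prefix:
  "drop_sum True ([a] @ d) F =
    drop_sum True [a] (\<lambda>v k. drop_sum False d (\<lambda>w l. F (v @ w) (k + l)))"
  by (rule drop_sum_append) simp

text \<open>For \<open>False\<close> the pairs are the two exponents of each factor, so every factor
  expands by itself.\<close>

lemma drop_sum_oe_left:
  "drop_sum False (exps_left p @ d) F =
    zsum p (\<lambda>r k. drop_sum False d (\<lambda>w l. F (exps_left r @ w) (k + l)))"
proof (induction p arbitrary: d)
  case (Cons b p)
  show ?case
    unfolding exps_left_simps append_assoc Cons drop_sum_even_prefix
    by (cases b) (simp_all add: xexp_def drop_sum_small exps_left_simps add.assoc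
      del: One_nat_def)
qed (simp add: exps_left_simps)

lemma drop_sum_oe_right:
  "drop_sum False (exps_right q) F = zsum q (\<lambda>r k. F (exps_right r) k)"
proof (induction q arbitrary: F)
  case (Cons b q)
  show ?case
    unfolding exps_right_simps drop_sum_even_prefix Cons
    by (cases b) (simp_all add: xexp_def drop_sum_small exps_right_simps zsum_add zsum_diff
      add.commute del: One_nat_def)
qed (simp add: exps_right_simps drop_sum_small)

text \<open>For \<open>True\<close> the first 1 has no partner, and each x-exponent is paired with
  the y-exponent 1 of the next factor. These pairs expand to the same words as in the other
  grouping; the final \<open>[1]\<close> starts the factor at the middle.\<close>

lemma drop_sum_eo_left:
  "drop_sum True (exps_left p @ [1] @ d) F =
    zsum p (\<lambda>r k. drop_sum False d (\<lambda>w l. F (exps_left r @ [1] @ w) (k + l)))"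
proof (induction p arbitrary: d)
  case Nil
  show ?case
    unfolding exps_left_simps append_Nil drop_sum_odd_prefix
    by (simp add: drop_sum_small exps_left_simps del: One_nat_def)
next
  case (Cons b p)
  have eq: "exps_left (b # p) @ [1] @ d = exps_left p @ [1] @ [xexp b, 1] @ d"
    by (simp add: exps_left_simps)
  show ?case
    unfolding eq Cons drop_sum_even_prefix
    by (cases b) (simp_all add: xexp_def drop_sum_small exps_left_simps add.assoc
        del: One_nat_def)
qed

text \<open>The leading 1 is the last exponent of the factor before; it shifts the pairs by one, and
  the final 1 stays alone.\<close>

lemma drop_sum_eo_right:
  "drop_sum False (1 # exps_right q) F = zsum q (\<lambda>r k. F (1 # exps_right r) k)"
proof (induction q arbitrary: F)
  case (Cons b q)
  have eq: "1 # exps_right (b # q) = [1, xexp b] @ (1 # exps_right q)"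
    by (simp add: exps_right_simps)
  show ?case
    unfolding eq drop_sum_even_prefix Cons
    by (cases b) (simp_all add: xexp_def drop_sum_small exps_right_simps zsum_add zsum_diff
      add.commute del: One_nat_def)
qed (simp add: exps_right_simps drop_sum_small del: One_nat_def)

lemma drop_sum_oe:
  "drop_sum False (exps_left p @ exps_right q) F =
    oe_sum p q (\<lambda>r r'. F (exps_left r @ exps_right r'))"
  by (simp add: drop_sum_oe_left drop_sum_oe_right oe_sum_def)

lemma drop_sum_eo:
  "drop_sum True (exps_left p @ exps_right q) F =
    eo_sum p q (\<lambda>r r'. F (exps_left r @ exps_right r'))"
proof (cases p)
  case Nil
  show ?thesis
  proof (cases q)
    case (Cons a q')
    have "exps_left p @ exps_right q = [xexp a] @ (1 # exps_right q')"
      by (simp add: Nil Cons exps_left_simps exps_right_simps)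
    then show ?thesis
      by (cases a) (simp_all only: Nil Cons drop_sum_odd_prefix, simp_all add: xexp_def drop_sum_small
        drop_sum_eo_right exps_left_simps exps_right_simps zsum_diff add.commute del: One_nat_def)
  qed (simp add: Nil exps_left_simps exps_right_simps drop_sum_small)
next
  case p: (Cons b p')
  show ?thesis
  proof (cases q)
    case Nil
    have "exps_left p @ exps_right q = exps_left p' @ [1] @ [xexp b]"
      by (simp add: Nil p exps_left_simps exps_right_simps)
    then show ?thesis
      by (cases b) (simp_all only: Nil p drop_sum_eo_left, simp_all add: xexp_def drop_sum_small
        exps_left_simps exps_right_simps del: One_nat_def)
  next
    case (Cons a q')
    \<comment> \<open>The middle pair joins the last factors of both monomials. If it is
      \<open>[1, 1]\<close> and disappears, the 1s around it form a new \<open>z 2\<close>, counted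
      on the left in \<open>eo_sum\<close>.\<close>
    have "exps_left p @ exps_right q = exps_left p' @ [1] @ [xexp b, xexp a] @ (1 # exps_right q')"
      by (simp add: Cons p exps_left_simps exps_right_simps)
    then show ?thesis
      by (cases a; cases b) (simp_all only: Cons p drop_sum_eo_left drop_sum_even_prefix,
          simp_all add: xexp_def drop_sum_small
        exps_left_simps exps_right_simps drop_sum_eo_right zsum_add zsum_diff add_ac del: One_nat_def)
  qed
qed

section \<open>Linearity and leading terms of the expansions\<close>

lemma oe_sum_diff: "oe_sum p q F - oe_sum p q G = oe_sum p q (\<lambda>r r' k. F r r' k - G r r' k)"
  by (simp add: oe_sum_def zsum_diff)

lemma eo_sum_diff: "eo_sum p q F - eo_sum p q G = eo_sum p q (\<lambda>r r' k. F r r' k - G r r' k)"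
  by (induction p q F rule: eo_sum.induct)
    (auto simp: zsum_diff algebra_simps intro!: arg_cong2[of _ _ _ _ zsum] ext)

text \<open>The degree; \<open>s\<close> has degree 1.\<close>

definition weight :: "bool list \<Rightarrow> nat" where
  "weight p = (\<Sum>b\<leftarrow>p. if b then 3 else 2)"

lemma weight_simps [simp]: "weight [] = 0" "weight (b # p) = (if b then 3 else 2) + weight p"
  by (simp_all add: weight_def)

text \<open>The substitution is homogeneous, and every term but the original monomial carries a
  positive power of s.\<close>

lemma zsum_leading:
  assumes "\<And>r k. weight r + k = weight p \<Longrightarrow> k > 0 \<Longrightarrow> F r k = 0"
  shows "zsum p F = F p 0"
  using assms
proof (induction p F rule: zsum.induct)
  case (2 p F)
  then show ?case by (subst zsum.simps, subst "2.IH") simp_all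
next
  case (3 p F)
  then show ?case by (subst zsum.simps, subst "3.IH") simp_all
qed simp

lemma oe_sum_leading:
  assumes "\<And>r r' k. weight r + weight r' + k = weight p + weight q \<Longrightarrow> k > 0 \<Longrightarrow> F r r' k = 0"
  shows "oe_sum p q F = F p q 0"
proof -
  have inner: "zsum q (\<lambda>r' l. F r r' (k + l)) = F r q k" if "weight r + k = weight p" for r k
    using that assms by (subst zsum_leading) simp_all
  have "oe_sum p q F = zsum q (\<lambda>r' l. F p r' (0 + l))"
    unfolding oe_sum_def using assms by (intro zsum_leading) (simp add: inner)
  then show ?thesis by (simp only: inner[of p 0] add_0_right)
qed

lemma eo_sum_leading:
  assumes "\<And>r r' k. weight r + weight r' + k = weight p + weight q \<Longrightarrow> k > 0 \<Longrightarrow> F r r' k = 0"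
  shows "eo_sum p q F = F p q 0"
  using assms
proof (induction p q F rule: eo_sum.induct)
  case (4 b p a q F)
  \<comment> \<open>\<open>G\<close> collects the terms from the last factors; the other factors
    expand as in \<open>oe_sum\<close>.\<close>
  define G where "G r r' k = F (b # r) (a # r') k
     - (if b then F (False # r) (a # r') (k + 1) else 0)
     - (if a then F (b # r) (False # r') (k + 1) else 0)
     + (if a \<or> b then 0 else F (False # r) r' (k + 2))" for r r' k
  have G: "G r r' k = F (b # r) (a # r') k"
    if "weight r + weight r' + k = weight p + weight q" for r r' k
    using that by (simp add: G_def 4)
  have "eo_sum (b # p) (a # q) F = oe_sum p q G"
    by (simp add: oe_sum_def G_def)
  also have "\<dots> = G p q 0"
    by (rule oe_sum_leading) (simp add: G 4)
  also have "\<dots> = F (b # p) (a # q) 0"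
    by (simp add: G)
  finally show ?case .
next
  case (2 b p F)
  then show ?case by (subst eo_sum.simps, subst zsum_leading) simp_all
next
  case (3 a q F)
  then show ?case by (subst eo_sum.simps, subst zsum_leading) simp_all
qed simp

section \<open>The same recursion for \<open>\<star>\<close>\<close>

definition rev_star :: "bool list \<Rightarrow> bool list \<Rightarrow> ncpoly" where
  "rev_star p q = star_rev (rev_word p) (rev_word q)"

lemma rev_word_in: "rev_word p \<in> rev_words23"
  by (induction p rule: rev_word.induct) (auto intro: rev_words23.intros)

lemma rev_star_simps:
  "rev_star [] [] = 1"
  "rev_star (False # p) q = rev_star p q * z 2"
  "rev_star p (False # q) = rev_star p q * z 2"
  "rev_star (True # p) [] = rev_star p [] * z 3"
  "rev_star [] (True # q) = rev_star [] q * z 3"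
  "rev_star (True # p) (True # q) =
    rev_star p (True # q) * z 3 + rev_star (True # p) q * z 3 + rev_star p q * z 2 ^ 3"
  by (simp_all add: rev_star_def star_rev_z2_left star_rev_z2_right rev_word_in star_rev_Nil
      z3 frag_of_mult frag_of_Nil)

text \<open>All factors but the last expand alike on both sides. For two last factors
  \<open>z 3\<close> the difference of the sides is the rule for \<open>\<star>\<close> times
  \<open>gx\<close>, as z_2 x^2 = z_3 x and z_2^2 y x^2 = z_2^3 x.\<close>

lemma rev_star_expansion:
  assumes "p \<noteq> [] \<or> q \<noteq> []"
  shows "eo_sum p q (\<lambda>r r' k. rev_star r r' * (gx + gy) * gx ^ k) =
    oe_sum p q (\<lambda>r r' k. rev_star r r' * gy * gx ^ k)"
proof -
  have z: "z 2 = gy * gx" "z 3 = gy * gx * gx"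
    by (simp_all add: z_def numeral_2_eq_2 mult.assoc)
  note simps = rev_star_simps oe_sum_def zsum_add zsum_diff z algebra_simps power3_eq_cube
  show ?thesis
  proof (cases p)
    case Nil
    then obtain a q' where q: "q = a # q'" using assms by (cases q) auto
    show ?thesis unfolding Nil q by (cases a) (simp_all add: simps)
  next
    case p: (Cons b p')
    show ?thesis
    proof (cases q)
      case Nil
      show ?thesis unfolding Nil p by (cases b) (simp_all add: simps)
    next
      case q: (Cons a q')
      show ?thesis unfolding p q by (cases a; cases b) (simp_all add: simps)
    qed
  qed
qed

lemma mult_gx_eq_0:
  assumes "p * gx = 0"
  shows "p = 0"
proof -
  \<comment> \<open>Deleting the last letter undoes right multiplication by
    \<open>gx\<close>.\<close>
  have "frag_extend (\<lambda>w. frag_of (butlast w)) (q * gx) = q" for q :: ncpoly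
    using subset_UNIV[of "Poly_Mapping.keys q"]
  proof (induction q rule: frag_induction)
    case (diff a b)
    then show ?case by (simp add: left_diff_distrib frag_extend_diff)
  qed (simp_all add: gx_def frag_of_mult)
  from this[of p] show ?thesis using assms by simp
qed

lemma drop1_exps_eq_rev_star: "drop1_exps (exps_left p @ exps_right q) = rev_star p q"
proof (induction "weight p + weight q" arbitrary: p q rule: less_induct)
  case less
  \<comment> \<open>Both functions satisfy the same linear identity, hence so does \<open>f\<close>.
    By induction \<open>f\<close> vanishes at smaller weight, so only the leading terms survive and
    give f (x + y) = f y.\<close>
  define f where "f r r' = drop1_exps (exps_left r @ exps_right r') - rev_star r r'" for r r'
  show ?case
  proof (cases "p = [] \<and> q = []")
    case True
    then show ?thesis
      by (subst drop1_exps.simps) (simp add: exps_left_simps exps_right_simps rev_star_simps)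
  next
    case False
    have "exps_left p @ exps_right q \<noteq> []"
      using False by (cases p; cases q) (simp_all add: exps_left_simps exps_right_simps)
    note drop1_exps_drop_sum[OF this, unfolded drop_sum_eo drop_sum_oe]
    moreover have "eo_sum p q (\<lambda>r r' k. rev_star r r' * (gx + gy) * gx ^ k) =
        oe_sum p q (\<lambda>r r' k. rev_star r r' * gy * gx ^ k)"
      by (rule rev_star_expansion) (use False in blast)
    ultimately have "eo_sum p q (\<lambda>r r' k. f r r' * (gx + gy) * gx ^ k) =
        oe_sum p q (\<lambda>r r' k. f r r' * gy * gx ^ k)"
      by (simp only: f_def left_diff_distrib oe_sum_diff[symmetric] eo_sum_diff[symmetric])
    moreover have f: "f r r' = 0" if "weight r + weight r' + k = weight p + weight q" "k > 0" for r r' k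
      using that less by (simp add: f_def)
    ultimately have "f p q * (gx + gy) = f p q * gy"
      by (simp add: eo_sum_leading oe_sum_leading f)
    then have "f p q * gx = 0" by (simp add: distrib_left)
    then have "f p q = 0" by (rule mult_gx_eq_0)
    then show ?thesis by (simp add: f_def)
  qed
qed

section \<open>Passage to \<open>H23\<close>\<close>

lemma exps_word_append: "even (length c) \<Longrightarrow> exps_word (c @ d) = exps_word c @ exps_word d"
  by (induction c rule: exps_word.induct) auto

lemma even_length_exps_left: "even (length (exps_left p))"
  by (induction p) (simp_all add: exps_left_simps)

lemma exps_word_left: "exps_word (exps_left p) = rev (rev_word p)"
  by (induction p rule: rev_word.induct)
    (simp_all add: exps_left_simps exps_word_append even_length_exps_left xexp_def,
      simp add: numeral_2_eq_2)

lemma exps_word_right: "exps_word (exps_right q) = map swap_letter (rev_word q)"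
  by (induction q rule: rev_word.induct) (simp_all add: exps_right_simps xexp_def numeral_2_eq_2)

lemma valid_exps_left_right: "valid_exps (exps_left p @ exps_right q)"
proof -
  have "valid_exps (exps_right q)"
    by (induction q) (simp_all add: exps_right_simps valid_exps_Nil valid_exps_Cons2 xexp_def)
  moreover have "valid_exps (exps_left p)"
    by (induction p) (auto simp: exps_left_simps valid_exps_def xexp_def)
  ultimately show ?thesis by (auto simp: valid_exps_def)
qed

lemma drop1_monomials:
  "drop1 (frag_of (rev (rev_word p)) * tau (frag_of (rev (rev_word q)))) =
    frag_of (rev (rev_word p)) \<star> frag_of (rev (rev_word q))"
proof -
  have "frag_of (rev (rev_word p)) * tau (frag_of (rev (rev_word q))) =
      frag_of (exps_word (exps_left p @ exps_right q))"
    by (simp add: tau_def frag_of_mult rev_map[symmetric] exps_word_append even_length_exps_left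
        exps_word_left exps_word_right)
  then show ?thesis
    by (simp add: drop1_exps_word valid_exps_left_right drop1_exps_eq_rev_star star_frag_of
        rev_star_def)
qed

lemma rev_word_append: "rev_word (p @ q) = rev_word p @ rev_word q"
  by (induction p rule: rev_word.induct) simp_all

text \<open>The words in z_2 and z_3 are closed under concatenation, so the polynomials supported on
  them form a subring.\<close>

lemma keys_H23:
  assumes "w \<in> H23"
  shows "Poly_Mapping.keys w \<subseteq> range (\<lambda>p. rev (rev_word p))"
proof -
  let ?W = "range (\<lambda>p. rev (rev_word p))"
  have "H23 \<subseteq> {w. Poly_Mapping.keys w \<subseteq> ?W}"
    unfolding H23_def
  proof (rule hull_minimal)
    have "rev (rev_word [False]) \<in> ?W" "rev (rev_word [True]) \<in> ?W" by blast+
    then show "{z 2, z 3} \<subseteq> {w. Poly_Mapping.keys w \<subseteq> ?W}"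
      by (simp add: z2 z3)
    have "rev (rev_word []) \<in> ?W" by blast
    then have one: "Poly_Mapping.keys (1 :: ncpoly) \<subseteq> ?W"
      by (simp add: zero_list_def)
    have diff: "Poly_Mapping.keys (a - b) \<subseteq> ?W"
      if "Poly_Mapping.keys a \<subseteq> ?W" "Poly_Mapping.keys b \<subseteq> ?W" for a b :: ncpoly
      using that keys_diff[of a b] by blast
    have mult: "Poly_Mapping.keys (a * b) \<subseteq> ?W"
      if "Poly_Mapping.keys a \<subseteq> ?W" "Poly_Mapping.keys b \<subseteq> ?W" for a b :: ncpoly
    proof
      fix w assume "w \<in> Poly_Mapping.keys (a * b)"
      then obtain u v where "w = u @ v" "u \<in> Poly_Mapping.keys a" "v \<in> Poly_Mapping.keys b"
        using keys_mult[of a b] by (auto simp: plus_list_def)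
      moreover from this have "u \<in> ?W" "v \<in> ?W" using that by blast+
      ultimately obtain p q where "w = rev (rev_word p) @ rev (rev_word q)" by blast
      then have "w = rev (rev_word (q @ p))" by (simp add: rev_word_append)
      then show "w \<in> ?W" by blast
    qed
    show "is_subring {w :: ncpoly. Poly_Mapping.keys w \<subseteq> ?W}"
      using one diff mult by (simp add: is_subring_def)
  qed
  then show ?thesis using assms by blast
qed

theorem theorem1p3:
  fixes w1 w2 :: ncpoly
  assumes "w1 \<in> H23" and "w2 \<in> H23"
  shows "drop1 (w1 * tau w2) = w1 \<star> w2"
proof -
  let ?W = "range (\<lambda>p. rev (rev_word p))"
  \<comment> \<open>Both sides are bilinear; \<open>w1\<close> is reduced to monomials first, for a
    fixed word in place of \<open>w2\<close>.\<close>
  have left: "drop1 (w1 * tau (frag_of v)) = w1 \<star> frag_of v" if "v \<in> ?W" for v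
    using keys_H23[OF assms(1)]
  proof (induction w1 rule: frag_induction)
    case (one u)
    then show ?case using that drop1_monomials by blast
  next
    case (diff a b)
    then show ?case by (simp add: left_diff_distrib drop1_def star_def frag_extend_diff)
  qed (simp add: drop1_def star_def)
  show ?thesis
    using keys_H23[OF assms(2)]
  proof (induction w2 rule: frag_induction)
    case zero
    show ?case using star_add_right[of w1 0 0] by (simp add: drop1_def tau_def)
  next
    case (one v)
    then show ?case by (rule left)
  next
    case (diff a b)
    have "w1 \<star> (a - b) = w1 \<star> a - w1 \<star> b"
      using star_add_right[of w1 "a - b" b] by simp
    moreover have "tau (a - b) = tau a - tau b" by (simp add: tau_def frag_extend_diff)
    ultimately show ?case using diff by (simp add: right_diff_distrib drop1_def frag_extend_diff)
  qed
qed

end
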